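(* Let $f:\mathbb{R}^n\to\mathbb{R}\cup\{+\infty\}$ be proper, lower semicontinuous and convex, $A\in\mathbb{R}^{m\times n}$, $b\in\mathbb{R}^m$, and let $X$ be the set of minimizers over $x\in\mathbb{R}^n$ of $f(x)+\frac12\|Ax-b\|^2$. Assume $X\neq\varnothing$. Then $X$ can be expressed in the following forms. (i) $X=(\partial f+A^\top A)^{-1}(A^\top b)$. (ii) $X=x_{\mathsf r}^\star+\big((\partial f^*(A^\top r)-x_{\mathsf r}^\star)\cap\ker A\big)$, where $x_{\mathsf r}^\star=A^\dagger\,(I_m+A\triangleright\partial f)^{-1}(b)$ and $r=b-Ax_{\mathsf r}^\star$. (iii) If a particular solution $x^\star\in X$ is given, then $X=x^\star+\big((\partial f^*(A^\top r)-x^\star)\cap\ker A\big)$, where $r=b-Ax^\star$.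
   Context: $f^*$ is the convex conjugate of $f$, $\partial$ the convex subdifferential, $A^\dagger$ the Moore–Penrose pseudoinverse, $I_m$ the $m\times m$ identity. For a set-valued operator $\mathcal B$, $\mathcal B^{-1}$ is its set-valued inverse ($x\in \mathcal B^{-1}(u)\iff u\in \mathcal B(x)$). The parallel composition of $\partial f$ by $A$ is the set-valued operator on $\mathbb{R}^m$ defined by $A\triangleright\partial f=(A\circ(\partial f)^{-1}\circ A^\top)^{-1}=(A\circ\partial f^*\circ A^\top)^{-1}$. The operator $(I_m+A\triangleright\partial f)^{-1}$ is at most single-valued, so its value at $b$, when nonempty, is identified with a point. All solutions $x^\star\in X$ have the same image $Ax^\star$. *)

theory Defs
  imports "HOL-Analysis.Analysis" "HOL-Library.Set_Algebras"
begin

definition proper_fun :: "('a \<Rightarrow> ereal) \<Rightarrow> bool" where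
  "proper_fun f \<longleftrightarrow> (\<forall>x. f x \<noteq> -\<infinity>) \<and> (\<exists>x. f x \<noteq> \<infinity>)"

definition lsc_fun :: "('a::topological_space \<Rightarrow> ereal) \<Rightarrow> bool" where
  "lsc_fun f \<longleftrightarrow> (\<forall>x. f x \<le> Liminf (at x) f)"

text \<open>Jensen's inequality, as in \<open>convex_on\<close>. It is used below only for functions that
  avoid \<open>-\<infinity>\<close>; the boundary cases are harmless because \<open>0 * \<infinity> = 0\<close> in \<open>ereal\<close>.\<close>

definition convex_fun :: "('a::real_vector \<Rightarrow> ereal) \<Rightarrow> bool" where
  "convex_fun f \<longleftrightarrow>
     (\<forall>x y. \<forall>u\<ge>0. \<forall>v\<ge>0. u + v = 1 \<longrightarrow>
        f (u *\<^sub>R x + v *\<^sub>R y) \<le> ereal u * f x + ereal v * f y)"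

definition conjugate :: "('a::real_inner \<Rightarrow> ereal) \<Rightarrow> 'a \<Rightarrow> ereal" where
  "conjugate f u = (SUP x. ereal (x \<bullet> u) - f x)"

text \<open>For proper \<open>f\<close> the subdifferential is empty wherever \<open>f x = \<infinity>\<close>.\<close>

definition subdiff :: "('a::real_inner \<Rightarrow> ereal) \<Rightarrow> 'a \<Rightarrow> 'a set" where
  "subdiff f x = {u. \<forall>y. f x + ereal (u \<bullet> (y - x)) \<le> f y}"

definition sv_inv :: "('a \<Rightarrow> 'b set) \<Rightarrow> 'b \<Rightarrow> 'a set" where
  "sv_inv B u = {x. u \<in> B x}"

text \<open>Pointwise Minkowski sum; \<open>+\<close> on the right is the one of \<open>Set_Algebras\<close>.\<close>

definition sv_add :: "('a \<Rightarrow> 'b::plus set) \<Rightarrow> ('a \<Rightarrow> 'b set) \<Rightarrow> 'a \<Rightarrow> 'b set" where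
  "sv_add B C x = B x + C x"

definition single :: "('a \<Rightarrow> 'b) \<Rightarrow> 'a \<Rightarrow> 'b set" where
  "single g x = {g x}"

definition parallel_comp ::
    "real^'n^'m \<Rightarrow> (real^'n \<Rightarrow> (real^'n) set) \<Rightarrow> real^'m \<Rightarrow> (real^'m) set" where
  "parallel_comp A B = sv_inv (\<lambda>v. (\<lambda>x. A *v x) ` sv_inv B (transpose A *v v))"

text \<open>The four Penrose conditions, which determine the Moore--Penrose pseudoinverse uniquely.\<close>

definition is_pinv :: "real^'n^'m \<Rightarrow> real^'m^'n \<Rightarrow> bool" where
  "is_pinv A P \<longleftrightarrow>
     A ** P ** A = A \<and> P ** A ** P = P \<and>
     transpose (A ** P) = A ** P \<and> transpose (P ** A) = P ** A"

definition pinv :: "real^'n^'m \<Rightarrow> real^'m^'n" where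
  "pinv A = (THE P. is_pinv A P)"

definition kernel :: "real^'n^'m \<Rightarrow> (real^'n) set" where
  "kernel A = {x. A *v x = 0}"

definition minimizers :: "(real^'n \<Rightarrow> ereal) \<Rightarrow> real^'n^'m \<Rightarrow> real^'m \<Rightarrow> (real^'n) set" where
  "minimizers f A b =
     {x. is_arg_min (\<lambda>x. f x + ereal (1/2 * (norm (A *v x - b))\<^sup>2)) (\<lambda>_. True) x}"

text \<open>\<open>x + ((S - x) \<inter> K)\<close>, where \<open>S - x\<close> is a translate (not a set difference).\<close>

definition translated_slice :: "'a::group_add \<Rightarrow> 'a set \<Rightarrow> 'a set \<Rightarrow> 'a set" where
  "translated_slice x S K = (\<lambda>z. x + z) ` ((\<lambda>y. y - x) ` S \<inter> K)"

end

theory Submission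
  imports Defs
begin

text \<open>The function \<open>x \<mapsto> (1/2) * (norm (A *v x - b))\<^sup>2\<close> is finite and differentiable
  with gradient \<open>transpose A *v (A *v x - b)\<close>, so Fermat's rule says that \<open>x\<close> minimizes the
  objective exactly when \<open>transpose A *v (b - A *v x) \<in> subdiff f x\<close> (\<open>minimizers_iff\<close>). All
  three forms of the solution set are readings of this inclusion.

  Moving \<open>transpose A *v (A *v x)\<close> to the other side gives form (i).

  The subdifferential is monotone. Hence two solutions \<open>x\<close> and \<open>y\<close> satisfy
  \<open>- (norm (A *v x - A *v y))\<^sup>2 \<ge> 0\<close>, so they have the same image under \<open>A\<close>
  (\<open>minimizers_same_image\<close>). The residual \<open>r = b - A *v x\<close> is therefore the same for every solution,
  and the solution set consists of the \<open>y\<close> with this common image and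
  \<open>transpose A *v r \<in> subdiff f y\<close>. By the Fenchel--Moreau type inversion rule
  \<open>subdiff_conjugate_iff\<close> the second condition says \<open>y \<in> subdiff (conjugate f) (transpose A *v r)\<close>,
  while the first says that \<open>y\<close> lies in a translate of the kernel of \<open>A\<close>. The base point of that
  translate may be any point with the common image, whether it is a solution or not
  (\<open>minimizers_eq_translated_slice\<close>). Taking a solution as base point gives form (iii).

  For form (ii), unfolding the parallel composition identifies the resolvent at \<open>b\<close> with the image
  under \<open>A\<close> of the solution set (\<open>resolvent_parallel_comp_eq_image\<close>), which is a single point
  \<open>p\<close>. Since \<open>p\<close> lies in the range of \<open>A\<close>, the Penrose identity \<open>A ** P ** A = A\<close> makes
  \<open>pinv A *v p\<close> a point with image \<open>p\<close>, hence an admissible base point. This identity can be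
  used because the Penrose conditions have exactly one solution (\<open>ex_pinv\<close>,
  \<open>is_pinv_unique\<close>).\<close>

section \<open>The Moore--Penrose pseudoinverse\<close>

lemma inner_transpose_mult:
  fixes A :: "real^'n^'m"
  shows "(transpose A *v v) \<bullet> x = v \<bullet> (A *v x)"
  by (simp add: dot_lmul_matrix)

text \<open>Split \<open>y\<close> into its orthogonal projection onto the range of \<open>A\<close> and a remainder; the remainder
  is orthogonal to the range, so \<open>transpose A\<close> annihilates it.\<close>

lemma normal_equations_solvable:
  fixes A :: "real^'n^'m"
  shows "\<exists>z. transpose A *v (A *v z) = transpose A *v y"
proof -
  have sub: "subspace (range (\<lambda>x. A *v x))"
    by (simp add: linear_subspace_image)
  obtain a w where a: "a \<in> span (range (\<lambda>x. A *v x))"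
    and w: "\<And>v. v \<in> span (range (\<lambda>x. A *v x)) \<Longrightarrow> orthogonal w v" and y: "y = a + w"
    using orthogonal_subspace_decomp_exists[of "range (\<lambda>x. A *v x)" y] by metis
  obtain z where z: "a = A *v z"
    using a sub by (auto simp: span_eq_iff[THEN iffD2])
  have "(transpose A *v w) \<bullet> x = 0" for x
    using w[of "A *v x"] unfolding inner_transpose_mult
    by (simp add: orthogonal_def span_base)
  then have "transpose A *v w = 0"
    using inner_eq_zero_iff by blast
  then have "transpose A *v (A *v z) = transpose A *v y"
    unfolding y z by (simp only: matrix_vector_right_distrib add_0_right)
  then show ?thesis ..
qed

text \<open>Solving the normal equations for every unit vector gives a matrix \<open>Z\<close> with
  \<open>transpose A ** A ** Z = transpose A\<close>. This one equation forces \<open>A ** Z\<close> to be the orthogonal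
  projection onto the range of \<open>A\<close>, which is what the two conclusions express.\<close>

lemma ex_least_squares_inverse:
  fixes A :: "real^'n^'m"
  obtains Z where "A ** Z ** A = A" and "transpose (A ** Z) = A ** Z"
proof -
  obtain z where z: "\<And>y. transpose A *v (A *v z y) = transpose A *v y"
    using normal_equations_solvable[of A] by metis
  define Z :: "real^'m^'n" where "Z = (\<chi> i j. z (axis j 1) $ i)"
  have col: "column j Z = z (axis j 1)" for j
    by (simp add: Z_def column_def vec_eq_iff)
  have "(transpose A ** A ** Z) *v axis j 1 = transpose A *v axis j 1" for j
    using z[of "axis j 1"]
    unfolding matrix_vector_mul_assoc[symmetric] matrix_vector_mult_basis[of Z] col .
  then have "column j (transpose A ** A ** Z) = column j (transpose A)" for j
    by (simp only: matrix_vector_mult_basis)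
  then have N: "transpose A ** A ** Z = transpose A"
    by (simp add: column_def vec_eq_iff)
  have N': "transpose Z ** transpose A ** A = A"
    using arg_cong[OF N, of transpose] by (simp add: matrix_transpose_mul matrix_mul_assoc)
  have sym: "transpose (A ** Z) = A ** Z"
  proof -
    have "transpose (A ** Z) = transpose Z ** (transpose A ** A ** Z)"
      by (simp only: matrix_transpose_mul N)
    also have "\<dots> = (transpose Z ** transpose A ** A) ** Z"
      by (simp only: matrix_mul_assoc)
    finally show ?thesis by (simp only: N')
  qed
  moreover have "A ** Z ** A = A"
    using N' unfolding matrix_transpose_mul[symmetric] sym .
  ultimately show ?thesis using that by blast
qed

text \<open>Urquhart's formula: if \<open>Z\<close> is an inner inverse of \<open>A\<close> with \<open>A ** Z\<close> symmetric, and \<open>U\<close> one with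
  \<open>U ** A\<close> symmetric, then \<open>U ** A ** Z\<close> satisfies all four Penrose conditions. The second kind
  of inverse is the transpose of one of the first kind for \<open>transpose A\<close>.\<close>

lemma ex_pinv:
  fixes A :: "real^'n^'m"
  shows "\<exists>P. is_pinv A P"
proof -
  obtain Z where Z: "A ** Z ** A = A" "transpose (A ** Z) = A ** Z"
    by (rule ex_least_squares_inverse)
  obtain Y where Y: "transpose A ** Y ** transpose A = transpose A"
      "transpose (transpose A ** Y) = transpose A ** Y"
    by (rule ex_least_squares_inverse)
  define U where "U = transpose Y"
  have U: "A ** U ** A = A" "transpose (U ** A) = U ** A"
    using arg_cong[OF Y(1), of transpose] Y(2)
    by (simp_all add: U_def matrix_transpose_mul matrix_mul_assoc)
  define P where "P = U ** A ** Z"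
  have AP: "A ** P = A ** Z"
    unfolding P_def by (simp only: matrix_mul_assoc U)
  have PA: "P ** A = U ** A"
    unfolding P_def by (metis matrix_mul_assoc Z(1))
  have "P ** A ** P = P"
    unfolding PA unfolding P_def by (metis matrix_mul_assoc U(1))
  then have "is_pinv A P"
    unfolding is_pinv_def by (simp add: AP PA Z U)
  then show ?thesis ..
qed

text \<open>For two solutions \<open>P\<close> and \<open>Q\<close>, both \<open>A ** P\<close> and \<open>A ** Q\<close> are the orthogonal projection onto
  the range of \<open>A\<close>, and both \<open>P ** A\<close> and \<open>Q ** A\<close> are the one onto the range of
  \<open>transpose A\<close>. Then \<open>P = P ** A ** P = Q ** A ** Q = Q\<close>.\<close>

lemma is_pinv_unique:
  fixes A :: "real^'n^'m"
  assumes P: "is_pinv A P" and Q: "is_pinv A Q"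
  shows "P = Q"
proof -
  have "A ** P = (A ** Q) ** (A ** P)"
    using Q unfolding is_pinv_def by (metis matrix_mul_assoc)
  also have "\<dots> = transpose ((A ** P) ** (A ** Q))"
    using P Q unfolding is_pinv_def by (simp only: matrix_transpose_mul[of "A ** P"])
  also have "(A ** P) ** (A ** Q) = A ** Q"
    using P unfolding is_pinv_def by (metis matrix_mul_assoc)
  also have "transpose (A ** Q) = A ** Q"
    using Q unfolding is_pinv_def by blast
  finally have AP: "A ** P = A ** Q" .
  have "P ** A = (P ** A) ** (Q ** A)"
    using Q unfolding is_pinv_def by (metis matrix_mul_assoc)
  also have "\<dots> = transpose ((Q ** A) ** (P ** A))"
    using P Q unfolding is_pinv_def by (simp only: matrix_transpose_mul[of "Q ** A"])
  also have "(Q ** A) ** (P ** A) = Q ** A"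
    using P unfolding is_pinv_def by (metis matrix_mul_assoc)
  also have "transpose (Q ** A) = Q ** A"
    using Q unfolding is_pinv_def by blast
  finally have PA: "P ** A = Q ** A" .
  have "P = P ** A ** P"
    using P by (simp add: is_pinv_def)
  also have "\<dots> = Q ** (A ** P)"
    by (simp add: PA matrix_mul_assoc)
  also have "\<dots> = Q"
    using Q by (simp add: AP is_pinv_def matrix_mul_assoc)
  finally show ?thesis .
qed

lemma is_pinv_pinv: "is_pinv A (pinv A)"
  unfolding pinv_def by (rule theI') (use ex_pinv is_pinv_unique in blast)

lemma mult_pinv_mult: "A *v (pinv A *v (A *v x)) = A *v x"
proof -
  have "A ** pinv A ** A = A" using is_pinv_pinv[of A] by (simp add: is_pinv_def)
  then show ?thesis by (metis matrix_vector_mul_assoc)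
qed

section \<open>Subgradients of a function and of its conjugate\<close>

lemma subdiff_finite:
  assumes "proper_fun f" and "u \<in> subdiff f x"
  obtains c where "f x = ereal c"
proof -
  obtain y where "f y \<noteq> \<infinity>" using assms(1) by (auto simp: proper_fun_def)
  moreover have "f x + ereal (u \<bullet> (y - x)) \<le> f y"
    using assms(2) by (auto simp: subdiff_def)
  ultimately have "f x \<noteq> \<infinity>" by auto
  then show ?thesis
    using assms(1) that by (cases "f x") (auto simp: proper_fun_def)
qed

text \<open>A bound on the conjugate at \<open>v\<close> is the same as an affine minorant of \<open>f\<close> with slope \<open>v\<close>. Through
  this rule all upper bounds on the conjugate below come from affine minorants.\<close>

lemma conjugate_le_iff:
  assumes "proper_fun f"
  shows "conjugate f v \<le> ereal k \<longleftrightarrow> (\<forall>y. ereal (v \<bullet> y - k) \<le> f y)"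
proof -
  have "ereal (y \<bullet> v) - f y \<le> ereal k \<longleftrightarrow> ereal (v \<bullet> y - k) \<le> f y" for y
    using assms by (cases "f y") (auto simp: proper_fun_def inner_commute algebra_simps)
  then show ?thesis by (auto simp: conjugate_def SUP_le_iff)
qed

lemma conjugate_ne_MInf:
  assumes "proper_fun f"
  shows "conjugate f v \<noteq> -\<infinity>"
proof -
  obtain y where y: "f y \<noteq> \<infinity>" "f y \<noteq> -\<infinity>" using assms by (auto simp: proper_fun_def)
  have "ereal (y \<bullet> v) - f y \<le> conjugate f v"
    unfolding conjugate_def by (rule SUP_upper) simp
  then show ?thesis using y by (cases "f y") auto
qed

text \<open>The lower limit in \<open>lsc_fun\<close> is taken over punctured neighbourhoods, so the point itself is
  treated separately when a strict lower bound is extended to a neighbourhood.\<close>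

lemma closed_epigraph_lsc:
  fixes f :: "'a::metric_space \<Rightarrow> ereal"
  assumes "lsc_fun f"
  shows "closed {(y, t). f y \<le> ereal t}"
  unfolding closed_def
proof (rule Topological_Spaces.openI)
  fix z assume "z \<in> - {(y, t). f y \<le> ereal t}"
  then obtain x t where z: "z = (x, t)" and "ereal t < f x" by (cases z) auto
  then obtain c where c: "t < c" "ereal c < f x"
    using ereal_dense2 by (metis less_ereal.simps(1))
  have "eventually (\<lambda>y. ereal c < f y) (at x)"
    using assms c(2) unfolding lsc_fun_def le_Liminf_iff by blast
  then obtain S where S: "open S" "x \<in> S" "\<And>y. y \<in> S \<Longrightarrow> y \<noteq> x \<Longrightarrow> ereal c < f y"
    unfolding eventually_at_topological by blast
  have "S \<times> {..<c} \<subseteq> - {(y, t). f y \<le> ereal t}"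
  proof clarsimp
    fix y s assume "y \<in> S" "s < c" "f y \<le> ereal s"
    moreover have "ereal c < f y" using S(3) c(2) \<open>y \<in> S\<close> by blast
    ultimately show False by (metis ereal_less_eq(3) leD less_imp_le order_less_le_trans)
  qed
  moreover have "open (S \<times> {..<c})" "z \<in> S \<times> {..<c}"
    using S c by (auto simp: z open_Times)
  ultimately show "\<exists>T. open T \<and> z \<in> T \<and> T \<subseteq> - {(y, t). f y \<le> ereal t}" by blast
qed

lemma convex_epigraph:
  assumes "convex_fun f"
  shows "convex {(y, t). f y \<le> ereal t}"
proof (rule convexI, clarsimp)
  fix x s y t and u v :: real
  assume a: "f x \<le> ereal s" "f y \<le> ereal t" "0 \<le> u" "0 \<le> v" "u + v = 1"
  have "f (u *\<^sub>R x + v *\<^sub>R y) \<le> ereal u * f x + ereal v * f y"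
    using assms a unfolding convex_fun_def by blast
  also have "\<dots> \<le> ereal u * ereal s + ereal v * ereal t"
    using a by (intro add_mono ereal_mult_left_mono) auto
  finally show "f (u *\<^sub>R x + v *\<^sub>R y) \<le> ereal (u * s + v * t)" by simp
qed

text \<open>The normal \<open>(s, \<alpha>)\<close> of a hyperplane below which \<open>(x, c)\<close> lies strictly cannot point downwards,
  because the epigraph contains a vertical upward ray. The hyperplane may still be vertical
  (\<open>\<alpha> = 0\<close>), which happens only when \<open>f x = \<infinity>\<close>.\<close>

lemma epigraph_separation:
  fixes f :: "'a::euclidean_space \<Rightarrow> ereal"
  assumes "proper_fun f" and "lsc_fun f" and "convex_fun f" and "ereal c < f x"
  obtains s \<alpha> \<beta> where "\<alpha> \<ge> 0" and "s \<bullet> x + \<alpha> * c < \<beta>"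
    and "\<And>y t. f y \<le> ereal t \<Longrightarrow> \<beta> < s \<bullet> y + \<alpha> * t"
proof -
  let ?E = "{(y, t). f y \<le> ereal t}"
  have "(x, c) \<notin> ?E" using assms(4) by auto
  then obtain a \<beta> where ab: "a \<bullet> (x, c) < \<beta>" "\<forall>z\<in>?E. a \<bullet> z > \<beta>"
    using separating_hyperplane_closed_point[OF convex_epigraph[OF assms(3)]
        closed_epigraph_lsc[OF assms(2)]] by blast
  obtain s \<alpha> where a: "a = (s, \<alpha>)" by (cases a)
  have sep: "\<beta> < s \<bullet> y + \<alpha> * t" if "f y \<le> ereal t" for y t
    using ab(2) that by (force simp: a)
  obtain y t0 where y: "f y = ereal t0"
    using assms(1) unfolding proper_fun_def by (metis ereal_cases)
  have "\<alpha> \<ge> 0"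
  proof (rule ccontr)
    assume "\<not> \<alpha> \<ge> 0"
    then have "\<alpha> < 0" by simp
    \<comment> \<open>High enough on the ray, the hyperplane with a downward normal is crossed.\<close>
    define t where "t = max t0 ((\<beta> - s \<bullet> y) / \<alpha>)"
    have "\<beta> < s \<bullet> y + \<alpha> * t" by (rule sep) (simp add: y t_def)
    moreover have "\<alpha> * t \<le> \<alpha> * ((\<beta> - s \<bullet> y) / \<alpha>)"
      using \<open>\<alpha> < 0\<close> by (intro mult_left_mono_neg) (auto simp: t_def)
    ultimately show False using \<open>\<alpha> < 0\<close> by simp
  qed
  then show ?thesis using that sep ab(1) by (simp add: a)
qed

text \<open>A hyperplane that is not vertical is the graph of an affine minorant, with slope
  \<open>- (s /\<^sub>R \<alpha>)\<close> and constant term \<open>\<beta> / \<alpha>\<close>.\<close>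

lemma conjugate_le_of_separation:
  assumes "proper_fun f" and "\<alpha> > 0" and "\<And>y t. f y \<le> ereal t \<Longrightarrow> \<beta> < s \<bullet> y + \<alpha> * t"
  shows "conjugate f (- (s /\<^sub>R \<alpha>)) \<le> ereal (- (\<beta> / \<alpha>))"
  unfolding conjugate_le_iff[OF assms(1)]
proof
  fix y
  show "ereal (- (s /\<^sub>R \<alpha>) \<bullet> y - - (\<beta> / \<alpha>)) \<le> f y"
  proof (cases "f y")
    case (real t)
    then show ?thesis using assms(3)[of y t] \<open>\<alpha> > 0\<close> by (simp add: field_simps)
  qed (use assms(1) in \<open>auto simp: proper_fun_def\<close>)
qed

text \<open>Separating the epigraph from a point just below the graph over the effective domain yields a
  hyperplane that cannot be vertical, hence an affine minorant of \<open>f\<close>.\<close>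

lemma proper_conjugate:
  fixes f :: "'a::euclidean_space \<Rightarrow> ereal"
  assumes "proper_fun f" and "lsc_fun f" and "convex_fun f"
  shows "proper_fun (conjugate f)"
proof -
  obtain x c where x: "f x = ereal c"
    using assms(1) unfolding proper_fun_def by (metis ereal_cases)
  then have "ereal (c - 1) < f x" by simp
  then obtain s \<alpha> \<beta> where sep: "\<alpha> \<ge> 0" "s \<bullet> x + \<alpha> * (c - 1) < \<beta>"
      "\<And>y t. f y \<le> ereal t \<Longrightarrow> \<beta> < s \<bullet> y + \<alpha> * t"
    using epigraph_separation[OF assms] by metis
  have "\<alpha> \<noteq> 0" using sep(2) sep(3)[of x c] x by auto
  then have "conjugate f (- (s /\<^sub>R \<alpha>)) \<le> ereal (- (\<beta> / \<alpha>))"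
    using sep by (intro conjugate_le_of_separation assms) auto
  then have "conjugate f (- (s /\<^sub>R \<alpha>)) \<noteq> \<infinity>" by auto
  then show ?thesis
    using conjugate_ne_MInf[OF assms(1)] unfolding proper_fun_def by blast
qed

text \<open>The implication from right to left is the equality case of the Fenchel--Young inequality. For the
  other one, put \<open>k = conjugate f u\<close>; the point is to show \<open>f x \<le> u \<bullet> x - k\<close>, because then the
  minorant \<open>\<lambda>y. u \<bullet> y - k\<close> touches \<open>f\<close> at \<open>x\<close>. Otherwise some point \<open>(x, c)\<close> strictly between the
  minorant and the graph can be separated from the epigraph. A non-vertical hyperplane is a
  minorant exceeding the first one at \<open>x\<close>; a vertical one can be tilted by adding it to the
  first one, with the same effect. Either contradicts the subgradient inequality of the conjugate
  at \<open>u\<close>, which says that no affine minorant exceeds \<open>u \<bullet> x - k\<close> at \<open>x\<close>.\<close>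

lemma subdiff_conjugate_iff:
  fixes f :: "'a::euclidean_space \<Rightarrow> ereal"
  assumes "proper_fun f" and "lsc_fun f" and "convex_fun f"
  shows "x \<in> subdiff (conjugate f) u \<longleftrightarrow> u \<in> subdiff f x"
proof
  assume u: "u \<in> subdiff f x"
  obtain c where c: "f x = ereal c" using subdiff_finite[OF assms(1) u] .
  have le: "conjugate f u \<le> ereal (u \<bullet> x - c)"
    unfolding conjugate_le_iff[OF assms(1)]
    using u by (auto simp: subdiff_def c inner_diff_right algebra_simps)
  show "x \<in> subdiff (conjugate f) u"
    unfolding subdiff_def
  proof clarify
    fix v
    have "conjugate f u + ereal (x \<bullet> (v - u)) \<le> ereal (u \<bullet> x - c) + ereal (x \<bullet> (v - u))"
      by (intro add_right_mono le)
    also have "\<dots> = ereal (x \<bullet> v) - f x"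
      by (simp add: c inner_diff_right inner_commute)
    also have "\<dots> \<le> conjugate f v"
      unfolding conjugate_def by (rule SUP_upper) simp
    finally show "conjugate f u + ereal (x \<bullet> (v - u)) \<le> conjugate f v" .
  qed
next
  assume x: "x \<in> subdiff (conjugate f) u"
  obtain k where k: "conjugate f u = ereal k"
    using subdiff_finite[OF proper_conjugate[OF assms] x] .
  have sub: "ereal (k + x \<bullet> (v - u)) \<le> conjugate f v" for v
    using x by (simp add: subdiff_def k)
  have minorant: "ereal (u \<bullet> y - k) \<le> f y" for y
    using k conjugate_le_iff[OF assms(1), of u k] by simp
  have fx: "f x \<le> ereal (u \<bullet> x - k)"
  proof (rule ccontr)
    assume "\<not> f x \<le> ereal (u \<bullet> x - k)"
    then obtain c where c: "u \<bullet> x - k < c" "ereal c < f x"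
      using ereal_dense2 by (metis less_ereal.simps(1) not_le)
    obtain s \<alpha> \<beta> where sep: "\<alpha> \<ge> 0" "s \<bullet> x + \<alpha> * c < \<beta>"
      "\<And>y t. f y \<le> ereal t \<Longrightarrow> \<beta> < s \<bullet> y + \<alpha> * t"
      using epigraph_separation[OF assms c(2)] by metis
    show False
    proof (cases "\<alpha> = 0")
      case True
      \<comment> \<open>On the effective domain \<open>s \<bullet> y\<close> exceeds \<open>\<beta>\<close>, so subtracting \<open>s \<bullet> y - \<beta>\<close> from the minorant
        leaves a minorant; at \<open>x\<close> the subtracted term is negative.\<close>
      have "conjugate f (u - s) \<le> ereal (k - \<beta>)"
        unfolding conjugate_le_iff[OF assms(1)]
      proof
        fix y
        show "ereal ((u - s) \<bullet> y - (k - \<beta>)) \<le> f y"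
        proof (cases "f y")
          case (real t)
          then show ?thesis
            using sep(3)[of y t] minorant[of y] by (simp add: True inner_diff_left)
        qed (use assms(1) in \<open>auto simp: proper_fun_def\<close>)
      qed
      with sub[of "u - s"] have "ereal (k + x \<bullet> (u - s - u)) \<le> ereal (k - \<beta>)"
        by (rule order_trans)
      then show False using sep(2) by (simp add: True inner_commute)
    next
      case False
      then have "\<alpha> > 0" using sep(1) by simp
      have "ereal (k + x \<bullet> (- (s /\<^sub>R \<alpha>) - u)) \<le> ereal (- (\<beta> / \<alpha>))"
        using sub conjugate_le_of_separation[OF assms(1) \<open>\<alpha> > 0\<close> sep(3)] by (rule order_trans)
      then have "k - (s \<bullet> x) / \<alpha> - u \<bullet> x \<le> - (\<beta> / \<alpha>)"
        by (simp add: inner_diff_right inner_commute divide_inverse mult.commute)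
      moreover have "c < \<beta> / \<alpha> - (s \<bullet> x) / \<alpha>"
        using sep(2) \<open>\<alpha> > 0\<close> by (simp add: field_simps)
      ultimately show False using c(1) by simp
    qed
  qed
  show "u \<in> subdiff f x"
    unfolding subdiff_def
  proof clarify
    fix y
    have "f x + ereal (u \<bullet> (y - x)) \<le> ereal (u \<bullet> x - k) + ereal (u \<bullet> (y - x))"
      by (intro add_right_mono fx)
    also have "\<dots> = ereal (u \<bullet> y - k)" by (simp add: inner_diff_right)
    also have "\<dots> \<le> f y" by (rule minorant)
    finally show "f x + ereal (u \<bullet> (y - x)) \<le> f y" .
  qed
qed

lemma subdiff_monotone:
  assumes "proper_fun f" and "u \<in> subdiff f x" and "v \<in> subdiff f y"
  shows "(u - v) \<bullet> (x - y) \<ge> 0"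
proof -
  obtain c where c: "f x = ereal c" using subdiff_finite[OF assms(1,2)] .
  obtain d where d: "f y = ereal d" using subdiff_finite[OF assms(1,3)] .
  have "f x + ereal (u \<bullet> (y - x)) \<le> f y" "f y + ereal (v \<bullet> (x - y)) \<le> f x"
    using assms by (auto simp: subdiff_def)
  then show ?thesis by (simp add: c d inner_diff_left inner_diff_right)
qed

section \<open>Optimality conditions for the regularized least-squares problem\<close>

lemma nonneg_if_nonneg_perturbation:
  fixes a k :: real
  assumes "\<And>t. 0 < t \<Longrightarrow> t \<le> 1 \<Longrightarrow> 0 \<le> a + t * k"
  shows "0 \<le> a"
proof (rule tendsto_lowerbound)
  show "((\<lambda>t. a + t * k) \<longlongrightarrow> a) (at_right 0)"
    by (auto intro!: tendsto_eq_intros)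
  show "\<forall>\<^sub>F t in at_right 0. 0 \<le> a + t * k"
    using eventually_at_right_real[of 0 1] by (rule eventually_mono) (auto intro: assms)
qed simp

lemma half_norm_square_add:
  fixes w e :: "'a::real_inner"
  shows "1/2 * (norm (w + t *\<^sub>R e))\<^sup>2 = 1/2 * (norm w)\<^sup>2 + t * (w \<bullet> e) + t\<^sup>2 * (1/2 * (norm e)\<^sup>2)"
  unfolding power2_norm_eq_inner
  by (simp add: inner_add_left inner_add_right inner_commute power2_eq_square algebra_simps)

text \<open>Sufficiency adds the subgradient inequality of \<open>f\<close> to that of the quadratic. For necessity,
  compare \<open>x\<close> with the points \<open>x + t *\<^sub>R (y - x)\<close>: convexity bounds the change of \<open>f\<close> by
  \<open>t * (f y - f x)\<close>, the quadratic changes by its linear part up to order \<open>t\<^sup>2\<close>, and dividing by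
  \<open>t\<close> and letting \<open>t\<close> tend to \<open>0\<close> leaves the subgradient inequality at \<open>y\<close>.\<close>

lemma minimizers_iff:
  fixes f :: "real^'n \<Rightarrow> ereal" and A :: "real^'n^'m"
  assumes "proper_fun f" and "convex_fun f"
  shows "x \<in> minimizers f A b \<longleftrightarrow> transpose A *v (b - A *v x) \<in> subdiff f x"
proof -
  define h where "h y = 1/2 * (norm (A *v y - b))\<^sup>2" for y
  have min: "x \<in> minimizers f A b \<longleftrightarrow> (\<forall>y. f x + ereal (h x) \<le> f y + ereal (h y))"
    by (auto simp: minimizers_def is_arg_min_def not_less h_def)
  have slope: "(transpose A *v (b - A *v x)) \<bullet> (y - x) = - ((A *v x - b) \<bullet> (A *v (y - x)))" for y
    unfolding inner_transpose_mult by (simp add: inner_diff_left)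
  have expand: "h (x + t *\<^sub>R (y - x)) =
      h x + t * ((A *v x - b) \<bullet> (A *v (y - x))) + t\<^sup>2 * (1/2 * (norm (A *v (y - x)))\<^sup>2)" for t y
  proof -
    have "A *v (x + t *\<^sub>R (y - x)) - b = (A *v x - b) + t *\<^sub>R (A *v (y - x))"
      by (simp add: matrix_vector_right_distrib matrix_vector_mult_scaleR)
    then show ?thesis by (simp only: h_def half_norm_square_add)
  qed
  show ?thesis
  proof
    assume "transpose A *v (b - A *v x) \<in> subdiff f x"
    then have sub: "f x + ereal (- ((A *v x - b) \<bullet> (A *v (y - x)))) \<le> f y" for y
      unfolding subdiff_def mem_Collect_eq slope by blast
    have "f x + ereal (h x) \<le> f y + ereal (h y)" for y
    proof -
      have "h y \<ge> h x + (A *v x - b) \<bullet> (A *v (y - x))"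
        using expand[of 1 y] by simp
      then show ?thesis
        using sub[of y] by (cases "f x"; cases "f y") auto
    qed
    then show "x \<in> minimizers f A b" by (simp add: min)
  next
    assume "x \<in> minimizers f A b"
    then have x: "f x + ereal (h x) \<le> f y + ereal (h y)" for y by (simp add: min)
    obtain y0 where "f y0 \<noteq> \<infinity>" using assms(1) by (auto simp: proper_fun_def)
    then have "f x \<noteq> \<infinity>" using x[of y0] by auto
    then obtain c where c: "f x = ereal c"
      using assms(1) by (cases "f x") (auto simp: proper_fun_def)
    have "f x + ereal (- ((A *v x - b) \<bullet> (A *v (y - x)))) \<le> f y" for y
    proof (cases "f y")
      case (real d)
      let ?g = "(A *v x - b) \<bullet> (A *v (y - x))" and ?q = "1/2 * (norm (A *v (y - x)))\<^sup>2"
      have "0 \<le> (d - c + ?g) + t * ?q" if t: "0 < t" "t \<le> 1" for t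
      proof -
        let ?z = "x + t *\<^sub>R (y - x)"
        have "?z = (1 - t) *\<^sub>R x + t *\<^sub>R y" by (simp add: algebra_simps)
        then have "f ?z \<le> ereal (1 - t) * f x + ereal t * f y"
          using assms(2) t unfolding convex_fun_def by simp
        then have "f ?z \<le> ereal ((1 - t) * c + t * d)" by (simp add: c real)
        then have "f ?z + ereal (h ?z) \<le> ereal ((1 - t) * c + t * d) + ereal (h ?z)"
          by (rule add_right_mono)
        with x[of ?z] have "ereal c + ereal (h x) \<le> ereal ((1 - t) * c + t * d) + ereal (h ?z)"
          unfolding c by (rule order_trans)
        then have "c + h x \<le> (1 - t) * c + t * d + h ?z" by simp
        also have "\<dots> = c + h x + t * ((d - c + ?g) + t * ?q)"
          unfolding expand[of t y] by (simp only: power2_eq_square ring_distribs ac_simps)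
        finally have "0 \<le> t * ((d - c + ?g) + t * ?q)" by linarith
        then show ?thesis using t by (simp add: zero_le_mult_iff)
      qed
      then have "0 \<le> d - c + ?g" by (rule nonneg_if_nonneg_perturbation)
      then show ?thesis by (simp add: c real)
    qed (use assms(1) in \<open>auto simp: proper_fun_def\<close>)
    then show "transpose A *v (b - A *v x) \<in> subdiff f x"
      unfolding subdiff_def mem_Collect_eq slope by blast
  qed
qed

text \<open>Monotonicity of the subdifferential, applied to the two optimality conditions, bounds
  \<open>- (norm (A *v x - A *v y))\<^sup>2\<close> from below by \<open>0\<close>.\<close>

lemma minimizers_same_image:
  fixes f :: "real^'n \<Rightarrow> ereal" and A :: "real^'n^'m"
  assumes "proper_fun f" and "convex_fun f"
    and "x \<in> minimizers f A b" and "y \<in> minimizers f A b"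
  shows "A *v x = A *v y"
proof -
  let ?u = "\<lambda>x. transpose A *v (b - A *v x)"
  have "0 \<le> (?u x - ?u y) \<bullet> (x - y)"
    using assms by (intro subdiff_monotone[OF assms(1)]) (simp_all only: minimizers_iff)
  also have "\<dots> = ((b - A *v x) - (b - A *v y)) \<bullet> (A *v (x - y))"
    by (simp only: inner_diff_left inner_transpose_mult)
  also have "\<dots> = - ((A *v x - A *v y) \<bullet> (A *v x - A *v y))"
    by (simp add: matrix_vector_mult_diff_distrib inner_diff_left inner_diff_right)
  finally have "(A *v x - A *v y) \<bullet> (A *v x - A *v y) = 0"
    using inner_ge_zero[of "A *v x - A *v y"] by linarith
  then show ?thesis by simp
qed

lemma translated_slice_kernel:
  "translated_slice x S (kernel A) = {y \<in> S. A *v y = A *v x}"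
  by (force simp: translated_slice_def kernel_def matrix_vector_mult_diff_distrib)

text \<open>The base point \<open>z\<close> need only share its image with a solution. This covers both a given solution
  and the point obtained from the pseudoinverse, which need not minimize anything.\<close>

lemma minimizers_eq_translated_slice:
  fixes f :: "real^'n \<Rightarrow> ereal" and A :: "real^'n^'m"
  assumes "proper_fun f" and "lsc_fun f" and "convex_fun f"
    and "x \<in> minimizers f A b" and "A *v z = A *v x"
  shows "minimizers f A b =
    translated_slice z (subdiff (conjugate f) (transpose A *v (b - A *v z))) (kernel A)"
proof (rule set_eqI)
  fix y
  have "y \<in> minimizers f A b \<longleftrightarrow> y \<in> minimizers f A b \<and> A *v y = A *v z"
    using minimizers_same_image[OF assms(1,3) _ assms(4)] assms(5) by auto
  also have "\<dots> \<longleftrightarrow> transpose A *v (b - A *v z) \<in> subdiff f y \<and> A *v y = A *v z"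
    unfolding minimizers_iff[OF assms(1,3)] by metis
  finally show "y \<in> minimizers f A b \<longleftrightarrow>
      y \<in> translated_slice z (subdiff (conjugate f) (transpose A *v (b - A *v z))) (kernel A)"
    unfolding translated_slice_kernel subdiff_conjugate_iff[OF assms(1-3)] by simp
qed

lemma minimizers_eq_inverse:
  fixes f :: "real^'n \<Rightarrow> ereal" and A :: "real^'n^'m"
  assumes "proper_fun f" and "convex_fun f"
  shows "minimizers f A b =
    sv_inv (sv_add (subdiff f) (single (\<lambda>x. (transpose A ** A) *v x))) (transpose A *v b)"
proof (rule set_eqI)
  fix x
  have "transpose A *v b \<in> subdiff f x + {(transpose A ** A) *v x}
      \<longleftrightarrow> transpose A *v b - (transpose A ** A) *v x \<in> subdiff f x"
    by (auto simp: set_plus_def) (metis add.commute diff_add_cancel)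
  also have "transpose A *v b - (transpose A ** A) *v x = transpose A *v (b - A *v x)"
    by (simp only: matrix_vector_mult_diff_distrib matrix_vector_mul_assoc)
  finally show "x \<in> minimizers f A b \<longleftrightarrow> x \<in>
      sv_inv (sv_add (subdiff f) (single (\<lambda>x. (transpose A ** A) *v x))) (transpose A *v b)"
    unfolding minimizers_iff[OF assms] by (simp only: sv_inv_def sv_add_def single_def mem_Collect_eq)
qed

lemma resolvent_parallel_comp_eq_image:
  fixes f :: "real^'n \<Rightarrow> ereal" and A :: "real^'n^'m"
  assumes "proper_fun f" and "convex_fun f"
  shows "sv_inv (sv_add (single (\<lambda>y. mat 1 *v y)) (parallel_comp A (subdiff f))) b =
    (\<lambda>x. A *v x) ` minimizers f A b"
proof (rule set_eqI)
  fix p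
  let ?B = "parallel_comp A (subdiff f)"
  have "p \<in> sv_inv (sv_add (single (\<lambda>y. mat 1 *v y)) ?B) b \<longleftrightarrow> b \<in> {p} + ?B p"
    by (simp only: sv_inv_def sv_add_def single_def mem_Collect_eq matrix_vector_mul_lid)
  also have "\<dots> \<longleftrightarrow> b - p \<in> ?B p"
    by (auto simp: set_plus_def) (metis add.commute diff_add_cancel)
  also have "\<dots> \<longleftrightarrow> (\<exists>x. transpose A *v (b - p) \<in> subdiff f x \<and> p = A *v x)"
    by (auto simp only: parallel_comp_def sv_inv_def mem_Collect_eq image_iff Bex_def)
  also have "\<dots> \<longleftrightarrow> p \<in> (\<lambda>x. A *v x) ` minimizers f A b"
    by (auto simp only: minimizers_iff[OF assms] image_iff Bex_def)
  finally show "p \<in> sv_inv (sv_add (single (\<lambda>y. mat 1 *v y)) ?B) b \<longleftrightarrow>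
      p \<in> (\<lambda>x. A *v x) ` minimizers f A b" .
qed

theorem theorem2p2:
  fixes f :: "real^'n \<Rightarrow> ereal" and A :: "real^'n^'m" and b :: "real^'m"
    and X :: "(real^'n) set"
  assumes "proper_fun f" and "lsc_fun f" and "convex_fun f"
    and "X = minimizers f A b" and "X \<noteq> {}"
  shows "X = sv_inv (sv_add (subdiff f) (single (\<lambda>x. (transpose A ** A) *v x))) (transpose A *v b)
    \<and> (\<exists>p. sv_inv (sv_add (single (\<lambda>y. mat 1 *v y)) (parallel_comp A (subdiff f))) b = {p} \<and>
          (let xr = pinv A *v p; r = b - A *v xr in
            X = translated_slice xr (subdiff (conjugate f) (transpose A *v r)) (kernel A)))
    \<and> (\<forall>x\<in>X. let r = b - A *v x in
            X = translated_slice x (subdiff (conjugate f) (transpose A *v r)) (kernel A))"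
proof -
  obtain xs where xs: "xs \<in> minimizers f A b" using assms(4,5) by blast
  show ?thesis
  proof (intro conjI exI ballI)
    show "X = sv_inv (sv_add (subdiff f) (single (\<lambda>x. (transpose A ** A) *v x))) (transpose A *v b)"
      unfolding assms(4) using assms(1,3) by (rule minimizers_eq_inverse)
  next
    have "(\<lambda>x. A *v x) ` minimizers f A b = {A *v xs}"
      using xs minimizers_same_image[OF assms(1,3) _ xs] by blast
    then show "sv_inv (sv_add (single (\<lambda>y. mat 1 *v y)) (parallel_comp A (subdiff f))) b = {A *v xs}"
      using resolvent_parallel_comp_eq_image[OF assms(1,3)] by metis
    show "let xr = pinv A *v (A *v xs); r = b - A *v xr in
        X = translated_slice xr (subdiff (conjugate f) (transpose A *v r)) (kernel A)"
      unfolding Let_def assms(4)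
      by (rule minimizers_eq_translated_slice[OF assms(1-3) xs mult_pinv_mult])
  next
    fix x assume "x \<in> X"
    then show "let r = b - A *v x in
        X = translated_slice x (subdiff (conjugate f) (transpose A *v r)) (kernel A)"
      unfolding Let_def assms(4)
      by (intro minimizers_eq_translated_slice[OF assms(1-3)]) auto
  qed
qed

end
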